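(* Given $t\in(0,\infty)^m$, $f\in(0,1]^m$, $g\in(0,\infty)^m$ and $H\in(0,\infty)$, the branch-and-bound algorithm $\mathsf{B}$ described in the context produces an optimal application portfolio for Ellis's problem $$\text{maximize } v(\mathcal{X})\quad\text{subject to }\mathcal{X}\subseteq\mathcal{C}=\{1,\dots,m\},\ \sum_{j\in\mathcal{X}}g_j\le H;$$ that is, it terminates and the portfolio $\mathcal{X}$ it returns is an optimal solution.
   Context: Let $Z_1,\dots,Z_m$ be independent Bernoulli random variables with $\Pr(Z_j=1)=f_j$, let $t_0=0$, and let $v(\mathcal{X})=\operatorname{E}\bigl[\max\{t_0,\max\{t_jZ_j:j\in\mathcal{X}\}\}\bigr]$, $v(\varnothing)=0$. It is assumed that $g_j\le H$ for each $j$ and $\sum_j g_j>H$. Nodes. A node is a partition $n=(\mathcal{I},\mathcal{O},\mathcal{N})$ of $\mathcal{C}$ into three (possibly empty) parts with $\sum_{j\in\mathcal{I}}g_j\le H$. Its residual budget is $\bar H=H-\sum_{j\in\mathcal{I}}g_j$. Its parameters $\gamma$ and $\bar t_j$ ($j\in\mathcal{N}$) are obtained as follows: start with $\gamma=0$ and $\bar t=t$; for each $k\in\mathcal{I}$ in turn, increase $\gamma$ by the current $f_k\bar t_k$, eliminate $k$, and replace each remaining $\bar t_j$ by $(1-f_k)\bar t_j$ if $\bar t_j\le\bar t_k$ and by $\bar t_j-f_k\bar t_k$ if $\bar t_j>\bar t_k$. Put $v_{\mathcal{I}}[n]=v(\mathcal{I})$ and let $v^*_{\mathrm{LP}}[n]$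 be the optimal value of the linear program: maximize $\gamma+\sum_{j\in\mathcal{N}}f_j\bar t_jx_j$ subject to $\sum_{j\in\mathcal{N}}g_jx_j\le\bar H$, $x_j\in[0,1]$ for $j\in\mathcal{N}$. Children. If $\mathcal{N}=\varnothing$, the node has no children and is called a leaf. If $\mathcal{N}\ne\varnothing$ and every $j\in\mathcal{N}$ has $g_j>\bar H$, the node has the single child $(\mathcal{I},\mathcal{O}\cup\mathcal{N},\varnothing)$. Otherwise choose $j\in\mathcal{N}$ with $g_j\le\bar H$ for which $f_j\bar t_j/g_j$ is highest; the node has two children, $(\mathcal{I}\cup\{j\},\mathcal{O},\mathcal{N}\setminus\{j\})$ and $(\mathcal{I},\mathcal{O}\cup\{j\},\mathcal{N}\setminus\{j\})$. Algorithm $\mathsf{B}$. Initialize the root node $n_0=(\varnothing,\varnothing,\mathcal{C})$, $L\gets0$, $\mathcal{X}\gets\varnothing$, and the candidate set $\mathfrak{T}\gets\{n_0\}$. Repeat: if $\mathfrak{T}=\varnothing$, return $\mathcal{X},L$. Otherwise choose $n\in\mathfrak{T}$ maximizing $v^*_{\mathrm{LP}}[n]$ and remove it from $\mathfrak{T}$; for each child $n'$ of $n$: if $L<v_{\mathcal{I}}[n']$, set $L\gets v_{\mathcal{I}}[n']$ and set $\mathcal{X}$ to the $\mathcal{I}$-set of $n'$; then, if $v^*_{\mathrm{LP}}[n]>L$ and $n'$ is not a leaf, add $n'$ to $\mathfrak{T}$. After processing the children, remove from $\mathfrak{T}$ every $n''$ with $L>v^*_{\mathrm{LP}}[n'']$.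 *)

theory Defs
  imports "HOL-Probability.Probability" "HOL-Library.Multiset"
begin

section \<open>Ellis's problem\<close>

text \<open>
  \<open>Z j \<omega>\<close> is the event that application \<open>j\<close> is successful; the inserted \<open>0\<close> is the value
  \<open>t\<^sub>0 = 0\<close> of the outside option, so that the empty portfolio has value 0.
\<close>

definition portfolio_value ::
    "'w measure \<Rightarrow> (nat \<Rightarrow> 'w \<Rightarrow> bool) \<Rightarrow> (nat \<Rightarrow> real) \<Rightarrow> nat set \<Rightarrow> real" where
  "portfolio_value M Z t X =
     (LINT \<omega>|M. Max (insert 0 ((\<lambda>j. t j * of_bool (Z j \<omega>)) ` X)))"

definition feasible_portfolio :: "nat \<Rightarrow> (nat \<Rightarrow> real) \<Rightarrow> real \<Rightarrow> nat set \<Rightarrow> bool" where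
  "feasible_portfolio m g H X \<longleftrightarrow> X \<subseteq> {1..m} \<and> (\<Sum>j\<in>X. g j) \<le> H"

definition optimal_portfolio ::
    "nat \<Rightarrow> (nat set \<Rightarrow> real) \<Rightarrow> (nat \<Rightarrow> real) \<Rightarrow> real \<Rightarrow> nat set \<Rightarrow> bool" where
  "optimal_portfolio m v g H X \<longleftrightarrow>
     feasible_portfolio m g H X \<and> (\<forall>Y. feasible_portfolio m g H Y \<longrightarrow> v Y \<le> v X)"


section \<open>Nodes\<close>

datatype node = Node (included: "nat set") (excluded: "nat set") (undecided: "nat set")

definition is_node :: "nat \<Rightarrow> (nat \<Rightarrow> real) \<Rightarrow> real \<Rightarrow> node \<Rightarrow> bool" where
  "is_node m g H n \<longleftrightarrow>
     included n \<union> excluded n \<union> undecided n = {1..m} \<and>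
     included n \<inter> excluded n = {} \<and> included n \<inter> undecided n = {} \<and>
     excluded n \<inter> undecided n = {} \<and>
     (\<Sum>j\<in>included n. g j) \<le> H"

definition residual_budget :: "(nat \<Rightarrow> real) \<Rightarrow> real \<Rightarrow> node \<Rightarrow> real" where
  "residual_budget g H n = H - (\<Sum>j\<in>included n. g j)"

text \<open>
  A pair \<open>(\<gamma>, s)\<close> holds the current constant and the current transformed utilities. Utilities are
  total functions: the entry of an eliminated index is not deleted, but it is never consulted
  again, since \<^term>\<open>sorted_list_of_set (included n)\<close> is duplicate-free and only the entries at
  undecided indices are used afterwards.
\<close>

definition eliminate ::
    "(nat \<Rightarrow> real) \<Rightarrow> nat \<Rightarrow> real \<times> (nat \<Rightarrow> real) \<Rightarrow> real \<times> (nat \<Rightarrow> real)" where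
  "eliminate f k = (\<lambda>(\<gamma>, s).
     (\<gamma> + f k * s k,
      \<lambda>j. if s j \<le> s k then (1 - f k) * s j else s j - f k * s k))"

definition node_params ::
    "(nat \<Rightarrow> real) \<Rightarrow> (nat \<Rightarrow> real) \<Rightarrow> node \<Rightarrow> real \<times> (nat \<Rightarrow> real)" where
  "node_params t f n = fold (eliminate f) (sorted_list_of_set (included n)) (0, t)"

abbreviation node_gamma :: "(nat \<Rightarrow> real) \<Rightarrow> (nat \<Rightarrow> real) \<Rightarrow> node \<Rightarrow> real" where
  "node_gamma t f n \<equiv> fst (node_params t f n)"

abbreviation node_util :: "(nat \<Rightarrow> real) \<Rightarrow> (nat \<Rightarrow> real) \<Rightarrow> node \<Rightarrow> nat \<Rightarrow> real" where
  "node_util t f n \<equiv> snd (node_params t f n)"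

text \<open>The order of elimination is immaterial, so fixing the increasing one loses no generality.\<close>

lemma eliminate_commute:
  assumes "0 \<le> f a" "f a \<le> 1" "0 \<le> f b" "f b \<le> 1"
  shows "eliminate f a \<circ> eliminate f b = eliminate f b \<circ> eliminate f a"
proof -
  define \<phi> :: "real \<Rightarrow> real \<Rightarrow> real \<Rightarrow> real" where "\<phi> p c x = x - p * min x c" for p c x
  have elim: "eliminate f k (\<gamma>, s) = (\<gamma> + f k * s k, \<lambda>j. \<phi> (f k) (s k) (s j))" for k \<gamma> s
    by (auto simp: eliminate_def \<phi>_def min_def algebra_simps)
  have mono: "\<phi> p c x \<le> \<phi> p c y" if p: "0 \<le> p" "p \<le> 1" and xy: "x \<le> y" for p c x y
  proof -
    have "p * (min y c - min x c) \<le> 1 * (min y c - min x c)"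
      using p xy by (intro mult_right_mono) auto
    also have "\<dots> \<le> y - x" using xy by (simp add: min_def)
    finally show ?thesis unfolding \<phi>_def right_diff_distrib by linarith
  qed
  have \<phi>_min: "min (\<phi> p c x) (\<phi> p c y) = \<phi> p c (min x y)" if "0 \<le> p" "p \<le> 1" for p c x y
    using mono[OF that, of x y c] mono[OF that, of y x c] by (cases "x \<le> y") (simp_all add: min_def)
  have expand: "\<phi> q (\<phi> p c d) (\<phi> p c x) =
      x - p * min x c - q * (min x d - p * min (min x d) c)"
    if "0 \<le> p" "p \<le> 1" for p q c d x
  proof -
    have "\<phi> q (\<phi> p c d) (\<phi> p c x) = \<phi> p c x - q * \<phi> p c (min x d)"
      unfolding \<phi>_min[OF that, symmetric] by (simp only: \<phi>_def)
    then show ?thesis by (simp only: \<phi>_def)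
  qed
  have comm: "\<phi> q (\<phi> p c d) (\<phi> p c x) = \<phi> p (\<phi> q d c) (\<phi> q d x)"
    if "0 \<le> p" "p \<le> 1" "0 \<le> q" "q \<le> 1" for p q c d x
  proof -
    have "min (min x d) c = min (min x c) d" by (simp add: min_def)
    then show ?thesis
      unfolding expand[OF that(1,2)] expand[OF that(3,4)] by (simp add: algebra_simps)
  qed
  have gam: "q * d + p * \<phi> q d c = p * c + q * \<phi> p c d" for p q c d
    unfolding \<phi>_def min.commute[of c d] by (simp add: algebra_simps)
  show ?thesis
  proof
    fix z :: "real \<times> (nat \<Rightarrow> real)"
    obtain \<gamma> s where z: "z = (\<gamma>, s)" by (cases z)
    have "\<gamma> + f b * s b + f a * \<phi> (f b) (s b) (s a) = \<gamma> + f a * s a + f b * \<phi> (f a) (s a) (s b)"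
      using gam[of "f b" "s b" "f a" "s a"] by simp
    moreover have "\<phi> (f a) (\<phi> (f b) (s b) (s a)) (\<phi> (f b) (s b) (s j)) =
        \<phi> (f b) (\<phi> (f a) (s a) (s b)) (\<phi> (f a) (s a) (s j))" for j
      using comm assms by blast
    ultimately show "(eliminate f a \<circ> eliminate f b) z = (eliminate f b \<circ> eliminate f a) z"
      by (simp only: z o_apply elim)
  qed
qed

lemma node_params_any_order:
  assumes "\<forall>j\<in>included n. 0 \<le> f j \<and> f j \<le> 1"
    and "distinct ks" "set ks = included n"
  shows "node_params t f n = fold (eliminate f) ks (0, t)"
proof -
  have fin: "finite (included n)" using assms(3) by (metis List.finite_set)
  have "mset (sorted_list_of_set (included n)) = mset ks"
    using assms(2,3) fin
    by (subst set_eq_iff_mset_eq_distinct[symmetric]) simp_all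
  moreover have "eliminate f x \<circ> eliminate f y = eliminate f y \<circ> eliminate f x"
    if "x \<in> included n" "y \<in> included n" for x y
    using eliminate_commute[of f x y] assms(1) that by blast
  ultimately have "fold (eliminate f) (sorted_list_of_set (included n)) = fold (eliminate f) ks"
    using fin by (intro fold_multiset_equiv) (simp_all only: set_sorted_list_of_set)
  then show ?thesis by (simp only: node_params_def)
qed

text \<open>
  For a node, the feasible region of the linear program is nonempty and compact, so the supremum
  is attained and is the optimal value.
\<close>

definition lp_feasible :: "(nat \<Rightarrow> real) \<Rightarrow> real \<Rightarrow> node \<Rightarrow> (nat \<Rightarrow> real) \<Rightarrow> bool" where
  "lp_feasible g H n x \<longleftrightarrow>
     (\<Sum>j\<in>undecided n. g j * x j) \<le> residual_budget g H n \<and>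
     (\<forall>j\<in>undecided n. 0 \<le> x j \<and> x j \<le> 1)"

definition lp_value ::
    "(nat \<Rightarrow> real) \<Rightarrow> (nat \<Rightarrow> real) \<Rightarrow> (nat \<Rightarrow> real) \<Rightarrow> real \<Rightarrow> node \<Rightarrow> real" where
  "lp_value t f g H n =
     (SUP x \<in> {x. lp_feasible g H n x}.
        node_gamma t f n + (\<Sum>j\<in>undecided n. f j * node_util t f n j * x j))"

abbreviation is_leaf :: "node \<Rightarrow> bool" where
  "is_leaf n \<equiv> undecided n = {}"

text \<open>
  \<open>children t f g H n K\<close>: \<open>K\<close> is a possible set of children of \<open>n\<close>. It is a relation because the
  branching index need not be unique.
\<close>

inductive children ::
    "(nat \<Rightarrow> real) \<Rightarrow> (nat \<Rightarrow> real) \<Rightarrow> (nat \<Rightarrow> real) \<Rightarrow> real \<Rightarrow> node \<Rightarrow> node set \<Rightarrow> bool"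
  for t f g H n where
  leaf: "is_leaf n \<Longrightarrow> children t f g H n {}"
| exhausted:
    "\<not> is_leaf n \<Longrightarrow> \<forall>j\<in>undecided n. g j > residual_budget g H n \<Longrightarrow>
     children t f g H n {Node (included n) (excluded n \<union> undecided n) {}}"
| branch:
    "j \<in> undecided n \<Longrightarrow> g j \<le> residual_budget g H n \<Longrightarrow>
     \<forall>i\<in>undecided n. g i \<le> residual_budget g H n \<longrightarrow>
        f i * node_util t f n i / g i \<le> f j * node_util t f n j / g j \<Longrightarrow>
     children t f g H n
       {Node (included n \<union> {j}) (excluded n) (undecided n - {j}),
        Node (included n) (excluded n \<union> {j}) (undecided n - {j})}"

lemma children_are_nodes:
  assumes "children t f g H n K" "is_node m g H n" "n' \<in> K"
  shows "is_node m g H n'"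
  using assms(1)
proof cases
  case leaf
  then show ?thesis using assms(3) by simp
next
  case exhausted
  have "n' = Node (included n) (excluded n \<union> undecided n) {}"
    using assms(3) exhausted(1) by simp
  then show ?thesis using assms(2) unfolding is_node_def by auto
next
  case (branch j)
  have "finite (included n)"
    using assms(2) unfolding is_node_def by (metis finite_Un finite_atLeastAtMost)
  moreover have j: "j \<notin> included n" "j \<notin> excluded n"
    using assms(2) branch(2) unfolding is_node_def by blast+
  ultimately have sum: "(\<Sum>i\<in>insert j (included n). g i) \<le> H"
    using branch(3) by (simp add: residual_budget_def)
  have "undecided n = insert j (undecided n - {j})" using branch(2) by blast
  then have un: "included n \<union> excluded n \<union> insert j (undecided n - {j}) = {1..m}"
    using assms(2) unfolding is_node_def by simp
  consider "n' = Node (included n \<union> {j}) (excluded n) (undecided n - {j})"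
    | "n' = Node (included n) (excluded n \<union> {j}) (undecided n - {j})"
    using assms(3) branch(1) by blast
  then show ?thesis
  proof cases
    case 1
    show ?thesis
      using assms(2) j un sum unfolding 1 is_node_def node.sel Un_insert_right Un_empty_right
      by (intro conjI) blast+
  next
    case 2
    show ?thesis
      using assms(2) j un unfolding 2 is_node_def node.sel Un_insert_right Un_empty_right
      by (intro conjI) blast+
  qed
qed


section \<open>The branch-and-bound algorithm\<close>

text \<open>A state consists of the candidate set, the incumbent value and the incumbent portfolio.\<close>

type_synonym bb_state = "node set \<times> real \<times> nat set"

definition bb_init :: "nat \<Rightarrow> bb_state" where
  "bb_init m = ({Node {} {} {1..m}}, 0, {})"

text \<open>
  Processing of the child \<open>n'\<close> of \<open>n\<close>. The admission test uses the bound of the parent \<open>n\<close> and the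
  already updated incumbent value.
\<close>

definition bb_visit ::
    "(nat set \<Rightarrow> real) \<Rightarrow> (nat \<Rightarrow> real) \<Rightarrow> (nat \<Rightarrow> real) \<Rightarrow> (nat \<Rightarrow> real) \<Rightarrow> real \<Rightarrow>
     node \<Rightarrow> node \<Rightarrow> bb_state \<Rightarrow> bb_state" where
  "bb_visit v t f g H n n' = (\<lambda>(T, L, X).
     let (L', X') = (if L < v (included n') then (v (included n'), included n') else (L, X));
         T' = (if lp_value t f g H n > L' \<and> \<not> is_leaf n' then insert n' T else T)
     in (T', L', X'))"

text \<open>
  One pass through the main loop. The algorithm leaves open the choice among maximizing
  candidates, the choice among tied branching indices and the order in which the children are
  visited (the list \<open>cs\<close>), so a pass is a relation.
\<close>

inductive bb_step ::
    "(nat set \<Rightarrow> real) \<Rightarrow> (nat \<Rightarrow> real) \<Rightarrow> (nat \<Rightarrow> real) \<Rightarrow> (nat \<Rightarrow> real) \<Rightarrow> real \<Rightarrow>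
     bb_state \<Rightarrow> bb_state \<Rightarrow> bool"
  for v t f g H where
  "n \<in> T \<Longrightarrow> \<forall>n'\<in>T. lp_value t f g H n' \<le> lp_value t f g H n \<Longrightarrow>
   children t f g H n (set cs) \<Longrightarrow> distinct cs \<Longrightarrow>
   fold (bb_visit v t f g H n) cs (T - {n}, L, X) = (T', L', X') \<Longrightarrow>
   bb_step v t f g H (T, L, X) (T' - {n''. L' > lp_value t f g H n''}, L', X')"

abbreviation bb_reachable ::
    "nat \<Rightarrow> (nat set \<Rightarrow> real) \<Rightarrow> (nat \<Rightarrow> real) \<Rightarrow> (nat \<Rightarrow> real) \<Rightarrow> (nat \<Rightarrow> real) \<Rightarrow> real \<Rightarrow>
     bb_state \<Rightarrow> bool" where
  "bb_reachable m v t f g H \<equiv> (bb_step v t f g H)\<^sup>*\<^sup>* (bb_init m)"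

text \<open>
  Every execution is finite and can only stop with an empty candidate set, whatever choices are
  made.
\<close>

definition bb_terminates ::
    "nat \<Rightarrow> (nat set \<Rightarrow> real) \<Rightarrow> (nat \<Rightarrow> real) \<Rightarrow> (nat \<Rightarrow> real) \<Rightarrow> (nat \<Rightarrow> real) \<Rightarrow> real \<Rightarrow> bool" where
  "bb_terminates m v t f g H \<longleftrightarrow>
     (\<nexists>\<sigma> :: nat \<Rightarrow> bb_state. \<sigma> 0 = bb_init m \<and> (\<forall>i. bb_step v t f g H (\<sigma> i) (\<sigma> (Suc i)))) \<and>
     (\<forall>T L X. bb_reachable m v t f g H (T, L, X) \<longrightarrow> T \<noteq> {} \<longrightarrow>
        (\<exists>s'. bb_step v t f g H (T, L, X) s'))"

definition bb_returns ::
    "nat \<Rightarrow> (nat set \<Rightarrow> real) \<Rightarrow> (nat \<Rightarrow> real) \<Rightarrow> (nat \<Rightarrow> real) \<Rightarrow> (nat \<Rightarrow> real) \<Rightarrow> real \<Rightarrow>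
     nat set \<Rightarrow> real \<Rightarrow> bool" where
  "bb_returns m v t f g H X L \<longleftrightarrow> bb_reachable m v t f g H ({}, L, X)"

end

theory Submission
  imports Defs
begin

text \<open>
  Optimality rests on the bound \<open>v Y \<le> lp_value n\<close> for every feasible portfolio \<open>Y\<close> that is
  compatible with the node \<open>n\<close>. Conditioning on \<open>Z k\<close> gives
  \<open>E (max (t k * Z k) R) = f k * t k + E (R - f k * min R (t k))\<close> for the best other offer
  \<open>R\<close>, and since \<open>x \<mapsto> x - f k * min x (t k)\<close> is increasing and fixes \<open>0\<close>, it can be pulled into the
  maximum defining \<open>R\<close>: eliminating an included index preserves the value. When all included
  indices are gone, the maximum of the remaining offers is at most their sum, which is the linear
  objective at the indicator of \<open>Y\<close>.

  It follows that every feasible portfolio is always either compatible with a candidate node or no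
  better than the incumbent. Termination holds since the sum of \<open>3 ^ card (undecided n)\<close> over the
  candidates strictly decreases.
\<close>

section \<open>Values of portfolios\<close>

definition best_offer :: "(nat \<Rightarrow> real) \<Rightarrow> (nat \<Rightarrow> bool) \<Rightarrow> nat set \<Rightarrow> real" where
  "best_offer t z X = Max (insert 0 ((\<lambda>j. t j * of_bool (z j)) ` X))"

lemma portfolio_value_eq_best_offer:
  "portfolio_value M Z t X = (LINT \<omega>|M. best_offer t (\<lambda>j. Z j \<omega>) X)"
  by (simp add: portfolio_value_def best_offer_def)

lemma best_offer_empty [simp]: "best_offer t z {} = 0"
  by (simp add: best_offer_def)

lemma best_offer_insert [simp]:
  assumes "finite X"
  shows "best_offer t z (insert k X) = max (t k * of_bool (z k)) (best_offer t z X)"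
  using assms by (simp add: best_offer_def insert_commute[of 0])

lemma best_offer_nonneg:
  assumes "finite X"
  shows "0 \<le> best_offer t z X"
  using assms by (simp add: best_offer_def)

text \<open>Independence of disjoint blocks is phrased through restricted families; this removes the
  restriction again.\<close>

lemma best_offer_restrict: "best_offer t (restrict z X) X = best_offer t z X"
  by (simp add: best_offer_def cong: image_cong_simp)

lemma best_offer_le_sum:
  assumes "finite X" "\<forall>j\<in>X. 0 \<le> t j"
  shows "best_offer t z X \<le> (\<Sum>j\<in>X. t j * of_bool (z j))"
  using assms
proof (induction X rule: finite_induct)
  case (insert k X)
  have "0 \<le> t k * of_bool (z k)" using insert.prems by simp
  moreover have "0 \<le> best_offer t z X" by (rule best_offer_nonneg[OF insert.hyps(1)])
  ultimately show ?case using insert by simp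
qed simp

lemma measurable_best_offer:
  assumes "finite X"
  shows "(\<lambda>z. best_offer t z X) \<in> borel_measurable (PiM X (\<lambda>_. count_space UNIV))"
proof (cases "X = {}")
  case False
  have "(\<lambda>z. t j * of_bool (z j)) \<in> borel_measurable (PiM X (\<lambda>_. count_space UNIV))"
    if "j \<in> X" for j
    using that by measurable
  \<comment> \<open>The inserted \<open>0\<close> can be pulled out as
    \<open>max 0 (Max ...)\<close> only when the image is nonempty; hence the case split.\<close>
  then have "(\<lambda>z. max 0 (Max ((\<lambda>j. t j * of_bool (z j)) ` X)))
      \<in> borel_measurable (PiM X (\<lambda>_. count_space UNIV))"
    using assms by (intro borel_measurable_max borel_measurable_Max) auto
  then show ?thesis using assms False by (simp add: best_offer_def)
qed simp

section \<open>The shift x - p * min x c and its commutation with maxima\<close>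

lemma min_shift_mono:
  fixes p c x y :: real
  assumes "0 \<le> p" "p \<le> 1" "x \<le> y"
  shows "x - p * min x c \<le> y - p * min y c"
proof -
  \<comment> \<open>Truncation at \<open>c\<close> increases no faster than the identity, so with p
    \<le> 1 the subtracted term cannot outgrow the increase of x.\<close>
  have "p * (min y c - min x c) \<le> 1 * (min y c - min x c)"
    using assms by (intro mult_right_mono) auto
  also have "\<dots> \<le> y - x" using assms by (simp add: min_def)
  finally show ?thesis unfolding right_diff_distrib by linarith
qed

lemma best_offer_min_shift:
  assumes "finite X" "0 \<le> p" "p \<le> 1" "0 \<le> c"
  shows "best_offer (\<lambda>j. t j - p * min (t j) c) z X =
    best_offer t z X - p * min (best_offer t z X) c"
  using assms(1)
proof (induction X rule: finite_induct)
  case empty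
  then show ?case using assms(4) by simp
next
  case (insert k X)
  let ?\<phi> = "\<lambda>x. x - p * min x c"
  have "mono ?\<phi>" using assms by (intro monoI min_shift_mono)
  then have "max (?\<phi> x) (?\<phi> y) = ?\<phi> (max x y)" for x y
    by (rule max_of_mono)
  \<comment> \<open>Here \<open>0 \<le> c\<close> matters: the shift fixes 0, so it commutes with
    the 0/1 factor.\<close>
  moreover have "?\<phi> (t k) * of_bool (z k) = ?\<phi> (t k * of_bool (z k))"
    using assms(4) by simp
  ultimately show ?case
    by (simp only: best_offer_insert[OF insert.hyps(1)] insert.IH)
qed

section \<open>The bound of a node\<close>

text \<open>Both branches of the update subtract \<open>f k\<close> times the smaller of the two
  utilities. In this form elimination is the shift with p = \<open>f k\<close> and c =
  \<open>s k\<close>.\<close>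

lemma eliminate_eq:
  "eliminate f k (\<gamma>, s) = (\<gamma> + f k * s k, \<lambda>j. s j - f k * min (s j) (s k))"
  by (auto simp: eliminate_def min_def algebra_simps)

section \<open>Expected best offers of independent applications\<close>

locale admission_lottery = prob_space M for M :: "'w measure" +
  fixes m :: nat and f :: "nat \<Rightarrow> real" and Z :: "nat \<Rightarrow> 'w \<Rightarrow> bool"
  assumes f_bounds: "j \<in> {1..m} \<Longrightarrow> 0 \<le> f j \<and> f j \<le> 1"
    and indep: "indep_vars (\<lambda>_. count_space UNIV) Z {1..m}"
    and bernoulli: "j \<in> {1..m} \<Longrightarrow>
      distr M (count_space UNIV) (Z j) = measure_pmf (bernoulli_pmf (f j))"
begin

lemma measurable_Z: "j \<in> {1..m} \<Longrightarrow> Z j \<in> measurable M (count_space UNIV)"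
  using indep by (simp add: indep_vars_def)

lemma integrable_offer:
  assumes "j \<in> {1..m}"
  shows "integrable M (\<lambda>\<omega>. of_bool (Z j \<omega>) :: real)"
proof (rule integrable_const_bound[where B = 1])
  have [measurable]: "Z j \<in> measurable M (count_space UNIV)" by (rule measurable_Z[OF assms])
  show "(\<lambda>\<omega>. of_bool (Z j \<omega>) :: real) \<in> borel_measurable M" by measurable
qed simp

lemma expectation_offer:
  assumes "j \<in> {1..m}"
  shows "expectation (\<lambda>\<omega>. of_bool (Z j \<omega>)) = f j"
proof -
  have "expectation (\<lambda>\<omega>. of_bool (Z j \<omega>) :: real) =
      (LINT b|distr M (count_space UNIV) (Z j). of_bool b)"
    by (rule integral_distr[OF measurable_Z[OF assms], symmetric]) simp
  then show ?thesis using f_bounds[OF assms] by (simp add: bernoulli[OF assms])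
qed

lemma integrable_best_offer:
  assumes "X \<subseteq> {1..m}"
  shows "integrable M (\<lambda>\<omega>. best_offer s (\<lambda>j. Z j \<omega>) X)"
proof -
  have "finite X" using assms finite_subset by blast
  then show ?thesis
    using assms
  proof (induction X rule: finite_induct)
    case (insert k X)
    then have "integrable M (\<lambda>\<omega>. s k * of_bool (Z k \<omega>))"
      by (intro integrable_mult_right integrable_offer) simp
    then show ?case using insert by (simp add: integrable_max)
  qed simp
qed

text \<open>The two variables are measurable functions of the disjoint blocks {k} and
  \<open>X\<close> of an independent family. The free \<open>h\<close> allows direct use for the
  gain that \<open>k\<close> adds to the best offer.\<close>

lemma indep_offer_best_offer:
  assumes "insert k X \<subseteq> {1..m}" "k \<notin> X"
    and h: "h \<in> borel_measurable borel"
  shows "indep_var borel (\<lambda>\<omega>. of_bool (Z k \<omega>) :: real) borel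
    (\<lambda>\<omega>. h (best_offer s (\<lambda>j. Z j \<omega>) X) :: real)"
proof -
  have fin: "finite X" using finite_subset[OF assms(1)] by simp
  have "indep_var borel
      ((\<lambda>z. of_bool (z k)) \<circ> (\<lambda>\<omega>. restrict (\<lambda>j. Z j \<omega>) {k})) borel
      ((\<lambda>z. h (best_offer s z X)) \<circ> (\<lambda>\<omega>. restrict (\<lambda>j. Z j \<omega>) X))"
  proof (rule indep_var_compose[OF indep_var_restrict[OF indep]])
    show "(\<lambda>z. of_bool (z k) :: real) \<in> borel_measurable (PiM {k} (\<lambda>_. count_space UNIV))"
      by (rule measurable_compose[OF measurable_component_singleton]) auto
    show "(\<lambda>z. h (best_offer s z X)) \<in> borel_measurable (PiM X (\<lambda>_. count_space UNIV))"
      by (rule measurable_compose[OF measurable_best_offer[OF fin] h])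
    show "{k} \<inter> X = {}" "{k} \<subseteq> {1..m}" "X \<subseteq> {1..m}"
      using assms(1,2) by auto
  qed
  then show ?thesis by (simp add: comp_def best_offer_restrict)
qed

lemma portfolio_value_insert:
  assumes "insert k X \<subseteq> {1..m}" "k \<notin> X" "0 \<le> s k"
  shows "portfolio_value M Z s (insert k X) =
    f k * s k + portfolio_value M Z (\<lambda>j. s j - f k * min (s j) (s k)) X"
proof -
  have fin: "finite X" using finite_subset[OF assms(1)] by simp
  have k: "k \<in> {1..m}" and X: "X \<subseteq> {1..m}" using assms(1) by auto
  define I where "I = (\<lambda>\<omega>. of_bool (Z k \<omega>) :: real)"
  define R where "R = (\<lambda>\<omega>. best_offer s (\<lambda>j. Z j \<omega>) X)"
  have R: "integrable M R" unfolding R_def by (rule integrable_best_offer[OF X])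
  have I: "integrable M I" unfolding I_def by (rule integrable_offer[OF k])
  have minR: "integrable M (\<lambda>\<omega>. min (R \<omega>) (s k))"
    using R by (intro integrable_min) auto
  have indep_min: "indep_var borel I borel (\<lambda>\<omega>. s k - min (R \<omega>) (s k))"
    unfolding I_def R_def
    by (rule indep_offer_best_offer[OF assms(1,2), where h = "\<lambda>x. s k - min x (s k)"]) measurable
  have gain: "integrable M (\<lambda>\<omega>. s k - min (R \<omega>) (s k))" using minR by simp
  have R_nonneg: "0 \<le> R \<omega>" for \<omega> unfolding R_def by (rule best_offer_nonneg[OF fin])
  \<comment> \<open>Success of \<open>k\<close> raises the best offer from R to max R (s k), a gain
    of s k - min R (s k); failure leaves R, because R \<ge> 0. The indicator thus appears as a
    factor, and independence splits the expectation of the product.\<close>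
  have "best_offer s (\<lambda>j. Z j \<omega>) (insert k X) = R \<omega> + I \<omega> * (s k - min (R \<omega>) (s k))" for \<omega>
    using R_nonneg[of \<omega>] by (simp add: fin R_def I_def max_def min_def)
  then have "portfolio_value M Z s (insert k X) =
      expectation (\<lambda>\<omega>. R \<omega> + I \<omega> * (s k - min (R \<omega>) (s k)))"
    by (simp only: portfolio_value_eq_best_offer)
  also have "\<dots> = expectation R + expectation I * expectation (\<lambda>\<omega>. s k - min (R \<omega>) (s k))"
    using indep_var_integrable[OF indep_min I gain]
      indep_var_lebesgue_integral[OF indep_min I gain] R
    by simp
  also have "\<dots> = expectation R + f k * (s k - expectation (\<lambda>\<omega>. min (R \<omega>) (s k)))"
    using minR expectation_offer[OF k] by (simp add: I_def prob_space)
  also have "\<dots> = f k * s k + expectation (\<lambda>\<omega>. R \<omega> - f k * min (R \<omega>) (s k))"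
    using minR R by (simp add: algebra_simps)
  \<comment> \<open>The integrand is now the shift of the best offer R, hence the best offer for
    shifted utilities.\<close>
  also have "(\<lambda>\<omega>. R \<omega> - f k * min (R \<omega>) (s k)) =
      (\<lambda>\<omega>. best_offer (\<lambda>j. s j - f k * min (s j) (s k)) (\<lambda>j. Z j \<omega>) X)"
    using f_bounds[OF k] assms(3) fin by (simp add: R_def best_offer_min_shift)
  finally show ?thesis by (simp only: portfolio_value_eq_best_offer)
qed

lemma portfolio_value_le_sum:
  assumes "X \<subseteq> {1..m}" "\<forall>j\<in>X. 0 \<le> s j"
  shows "portfolio_value M Z s X \<le> (\<Sum>j\<in>X. f j * s j)"
proof -
  have fin: "finite X" using assms(1) finite_subset by blast
  have int: "integrable M (\<lambda>\<omega>. s j * of_bool (Z j \<omega>))" if "j \<in> X" for j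
    using assms(1) that by (intro integrable_mult_right integrable_offer) auto
  have "portfolio_value M Z s X \<le> expectation (\<lambda>\<omega>. \<Sum>j\<in>X. s j * of_bool (Z j \<omega>))"
    unfolding portfolio_value_eq_best_offer
    using int by (intro integral_mono integrable_best_offer assms(1) best_offer_le_sum fin
        assms(2) Bochner_Integration.integrable_sum)
  also have "\<dots> = (\<Sum>j\<in>X. s j * expectation (\<lambda>\<omega>. of_bool (Z j \<omega>)))"
    using int by (simp add: Bochner_Integration.integral_sum)
  also have "\<dots> = (\<Sum>j\<in>X. f j * s j)"
    using assms(1) by (intro sum.cong refl) (metis expectation_offer mult.commute subsetD)
  finally show ?thesis .
qed

text \<open>Iterates \<open>portfolio_value_insert\<close> along \<open>ks\<close>, while the
  utilities of \<open>S\<close> are transformed too. Nonnegativity is part of the conclusion because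
  each single elimination requires it of the current utility and the later bound by a sum requires
  it of the final ones.\<close>

lemma portfolio_value_eliminate:
  assumes "distinct ks" "set ks \<union> S \<subseteq> {1..m}" "set ks \<inter> S = {}"
    and "\<forall>j\<in>{1..m}. 0 \<le> s j"
    and "fold (eliminate f) ks (\<gamma>, s) = (\<gamma>', s')"
  shows "\<gamma> + portfolio_value M Z s (set ks \<union> S) = \<gamma>' + portfolio_value M Z s' S
    \<and> (\<forall>j\<in>{1..m}. 0 \<le> s' j)"
  using assms
proof (induction ks arbitrary: \<gamma> s)
  case (Cons k ks)
  let ?s = "\<lambda>j. s j - f k * min (s j) (s k)"
  have k: "k \<in> {1..m}" using Cons.prems(2) by auto
  have nonneg: "0 \<le> ?s j" if "j \<in> {1..m}" for j
    \<comment> \<open>Monotonicity is used from 0 to \<open>s j\<close>; the shift of 0 is 0 since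
      \<open>s k\<close> is nonnegative.\<close>
    using min_shift_mono[of "f k" 0 "s j" "s k"] f_bounds[OF k] Cons.prems(4) that k by simp
  have "\<gamma> + f k * s k + portfolio_value M Z ?s (set ks \<union> S) = \<gamma>' + portfolio_value M Z s' S
      \<and> (\<forall>j\<in>{1..m}. 0 \<le> s' j)"
    using Cons.prems nonneg by (intro Cons.IH) (auto simp: eliminate_eq)
  moreover have "portfolio_value M Z s (insert k (set ks \<union> S)) =
      f k * s k + portfolio_value M Z ?s (set ks \<union> S)"
    using Cons.prems k by (intro portfolio_value_insert) auto
  ultimately show ?case by simp
qed simp

end

section \<open>The linear program as a bound for all portfolios compatible with a node\<close>

definition compatible :: "node \<Rightarrow> nat set \<Rightarrow> bool" where
  "compatible n Y \<longleftrightarrow> included n \<subseteq> Y \<and> Y \<subseteq> included n \<union> undecided n"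

lemma is_node_subset:
  assumes "is_node m g H n"
  shows "included n \<subseteq> {1..m}" "undecided n \<subseteq> {1..m}"
    "finite (included n)" "finite (undecided n)"
proof -
  show 1: "included n \<subseteq> {1..m}" "undecided n \<subseteq> {1..m}"
    using assms unfolding is_node_def by blast+
  then show "finite (included n)" "finite (undecided n)"
    using finite_subset by blast+
qed

text \<open>A supremum of reals dominates its members only if they are bounded above. Since each x j
  lies in [0,1], the absolute values of the coefficients supply a bound.\<close>

lemma lp_value_upper:
  assumes "finite (undecided n)" "lp_feasible g H n x"
  shows "node_gamma t f n + (\<Sum>j\<in>undecided n. f j * node_util t f n j * x j) \<le> lp_value t f g H n"
  unfolding lp_value_def
proof (rule cSUP_upper)
  show "x \<in> {x. lp_feasible g H n x}" using assms(2) by simp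
  show "bdd_above ((\<lambda>x. node_gamma t f n + (\<Sum>j\<in>undecided n. f j * node_util t f n j * x j)) `
      {x. lp_feasible g H n x})"
  proof (rule bdd_aboveI2)
    fix y assume "y \<in> {x. lp_feasible g H n x}"
    then have y: "0 \<le> y j \<and> y j \<le> 1" if "j \<in> undecided n" for j
      using that by (simp add: lp_feasible_def)
    have "f j * node_util t f n j * y j \<le> \<bar>f j * node_util t f n j\<bar>" if "j \<in> undecided n" for j
    proof -
      have "f j * node_util t f n j * y j \<le> \<bar>f j * node_util t f n j\<bar> * y j"
        using y[OF that] by (intro mult_right_mono) auto
      also have "\<dots> \<le> \<bar>f j * node_util t f n j\<bar>"
        using y[OF that] by (intro mult_left_le) auto
      finally show ?thesis .
    qed
    then show "node_gamma t f n + (\<Sum>j\<in>undecided n. f j * node_util t f n j * y j) \<le>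
        node_gamma t f n + (\<Sum>j\<in>undecided n. \<bar>f j * node_util t f n j\<bar>)"
      by (intro add_left_mono sum_mono)
  qed
qed

text \<open>The indicator costs exactly what \<open>Y\<close> spends beyond
  \<open>included n\<close>, which the residual budget covers because \<open>Y\<close> respects
  \<open>H\<close>.\<close>

lemma lp_feasible_indicator:
  assumes "is_node m g H n" "feasible_portfolio m g H Y" "compatible n Y"
  shows "lp_feasible g H n (\<lambda>j. of_bool (j \<in> Y))"
proof -
  note sub = is_node_subset[OF assms(1)]
  have disj: "included n \<inter> undecided n = {}" using assms(1) by (simp add: is_node_def)
  have "(\<Sum>j\<in>undecided n. g j * of_bool (j \<in> Y)) = sum g (undecided n \<inter> Y)"
    using sub(4) by (simp add: sum.inter_restrict of_bool_def if_distrib cong: if_cong)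
  moreover have "Y = included n \<union> (undecided n \<inter> Y)"
    using assms(3) by (auto simp: compatible_def)
  moreover have "sum g (included n \<union> (undecided n \<inter> Y)) =
      sum g (included n) + sum g (undecided n \<inter> Y)"
    using sub disj by (intro sum.union_disjoint) auto
  ultimately show ?thesis
    using assms(2) by (simp add: lp_feasible_def residual_budget_def feasible_portfolio_def)
qed

lemma (in admission_lottery) portfolio_value_le_lp_value:
  assumes "is_node m g H n" "feasible_portfolio m g H Y" "compatible n Y"
    and "\<forall>j\<in>{1..m}. 0 \<le> t j"
  shows "portfolio_value M Z t Y \<le> lp_value t f g H n"
proof -
  note sub = is_node_subset[OF assms(1)]
  define S where "S = undecided n \<inter> Y"
  have disj: "included n \<inter> S = {}" using assms(1) by (auto simp: is_node_def S_def)
  have Y: "Y = included n \<union> S" using assms(3) by (auto simp: compatible_def S_def)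
  have S: "S \<subseteq> {1..m}" using sub(2) by (auto simp: S_def)
  let ?ks = "sorted_list_of_set (included n)"
  \<comment> \<open>The summand 0 is the initial constant in \<open>node_params\<close>; it makes
    the statement an instance of the elimination lemma.\<close>
  have "0 + portfolio_value M Z t (set ?ks \<union> S) =
      node_gamma t f n + portfolio_value M Z (node_util t f n) S
      \<and> (\<forall>j\<in>{1..m}. 0 \<le> node_util t f n j)"
    using sub S disj assms(4) by (intro portfolio_value_eliminate) (auto simp: node_params_def)
  then have eq: "portfolio_value M Z t Y =
      node_gamma t f n + portfolio_value M Z (node_util t f n) S"
    and nonneg: "\<forall>j\<in>{1..m}. 0 \<le> node_util t f n j"
    using sub(3) by (simp_all add: Y)
  have "portfolio_value M Z (node_util t f n) S \<le> (\<Sum>j\<in>S. f j * node_util t f n j)"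
    using S nonneg by (intro portfolio_value_le_sum) auto
  also have "\<dots> = (\<Sum>j\<in>undecided n. f j * node_util t f n j * of_bool (j \<in> Y))"
    using sub(4) by (simp add: S_def sum.inter_restrict of_bool_def if_distrib cong: if_cong)
  finally have "portfolio_value M Z t Y \<le> node_gamma t f n +
      (\<Sum>j\<in>undecided n. f j * node_util t f n j * of_bool (j \<in> Y))"
    using eq by simp
  also have "\<dots> \<le> lp_value t f g H n"
    by (rule lp_value_upper[OF sub(4) lp_feasible_indicator[OF assms(1-3)]])
  finally show ?thesis .
qed

section \<open>Children\<close>

text \<open>Shows that the loop never gets stuck at a chosen node: among finitely many affordable
  indices one has the highest ratio. Finiteness of \<open>K\<close> allows the children to be
  listed.\<close>

lemma ex_children:
  assumes "finite (undecided n)"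
  shows "\<exists>K. finite K \<and> children t f g H n K"
proof -
  define A where "A = {j \<in> undecided n. g j \<le> residual_budget g H n}"
  define r where "r j = f j * node_util t f n j / g j" for j
  consider "is_leaf n" | "\<not> is_leaf n" "A = {}" | "A \<noteq> {}" by blast
  then show ?thesis
  proof cases
    case 1
    then show ?thesis using children.leaf by blast
  next
    case 2
    then have "\<forall>j\<in>undecided n. g j > residual_budget g H n" by (auto simp: A_def not_le)
    then show ?thesis using children.exhausted[OF 2(1)] by blast
  next
    case 3
    have fin: "finite A" using assms by (simp add: A_def)
    then have "Max (r ` A) \<in> r ` A" using 3 by simp
    then obtain j where j: "j \<in> A" "r j = Max (r ` A)" by force
    have "\<forall>i\<in>undecided n. g i \<le> residual_budget g H n \<longrightarrow> r i \<le> r j"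
      using fin j(2) by (simp add: A_def)
    then show ?thesis
      using j(1) children.branch[of j n g H f t] unfolding A_def r_def
      by (intro exI conjI) auto
  qed
qed

text \<open>A branching yields at most two children, each with one undecided index fewer, and 2 *
  3^(k-1) < 3^k; so base 3 makes the weight drop. In the other cases the sum is 0, or 1 with k
  positive.\<close>

lemma card_undecided_children:
  assumes "children t f g H n K" "finite (undecided n)"
  shows "(\<Sum>c\<in>K. 3 ^ card (undecided c)) < (3 :: nat) ^ card (undecided n)"
  using assms(1)
proof cases
  case exhausted
  then have "card (undecided n) \<noteq> 0" using assms(2) by simp
  then have "1 < (3 :: nat) ^ card (undecided n)" by (intro one_less_power) auto
  then show ?thesis using exhausted(1) by simp
next
  case (branch j)
  have "card (undecided n) = Suc (card (undecided n - {j}))"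
    using assms(2) branch(2) by (rule card.remove)
  \<comment> \<open>An inequality suffices, so it need not be decided whether the two children
    differ.\<close>
  moreover have "(\<Sum>c\<in>K. (3 :: nat) ^ card (undecided c)) \<le> 2 * 3 ^ card (undecided n - {j})"
    by (simp add: branch(1) sum.insert_if)
  moreover have "(0 :: nat) < 3 ^ card (undecided n - {j})" by simp
  ultimately show ?thesis by (simp only: power_Suc)
qed simp

text \<open>Branching loses no feasible portfolio: \<open>Y\<close> goes to the child that agrees
  with it on \<open>j\<close>. If no undecided index is affordable, adding one to
  \<open>included n\<close> already breaks the budget, and nonnegative costs cannot repair this, so
  \<open>Y\<close> equals \<open>included n\<close>.\<close>

lemma compatible_child:
  assumes "children t f g H n K" "is_node m g H n" "\<not> is_leaf n"
    and "\<forall>j\<in>{1..m}. 0 \<le> g j" "feasible_portfolio m g H Y" "compatible n Y"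
  shows "\<exists>c\<in>K. compatible c Y"
  using assms(1)
proof cases
  case exhausted
  have "j \<notin> Y" if j: "j \<in> undecided n" for j
  proof
    assume "j \<in> Y"
    have "Y \<subseteq> {1..m}" using assms(5) by (simp add: feasible_portfolio_def)
    moreover have "insert j (included n) \<subseteq> Y"
      using \<open>j \<in> Y\<close> assms(6) by (simp add: compatible_def)
    ultimately have "sum g (insert j (included n)) \<le> sum g Y"
      using assms(4) finite_subset[OF \<open>Y \<subseteq> {1..m}\<close>] by (intro sum_mono2) auto
    moreover have "j \<notin> included n" using assms(2) j by (auto simp: is_node_def)
    ultimately have "g j + sum g (included n) \<le> H"
      using assms(5) is_node_subset[OF assms(2)] by (simp add: feasible_portfolio_def)
    then show False using exhausted(3) j by (force simp: residual_budget_def)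
  qed
  then have "Y = included n" using assms(6) by (auto simp: compatible_def)
  then show ?thesis using exhausted(1) by (simp add: compatible_def)
next
  case (branch j)
  then show ?thesis using assms(6) by (cases "j \<in> Y") (auto simp: compatible_def)
qed (use assms(3) in simp)

section \<open>The main loop\<close>

text \<open>Each child is tested against the incumbent value at the time of its visit. That value
  only grows and the candidate set only gains members during the pass, so the outcome of every test
  can be stated with the final \<open>L'\<close> and \<open>T'\<close>.\<close>

lemma fold_bb_visit:
  assumes "fold (bb_visit v t f g H n) cs (T, L, X) = (T', L', X')" "L = v X"
  shows "T \<subseteq> T'" "T' \<subseteq> T \<union> {c \<in> set cs. \<not> is_leaf c}"
    "L \<le> L'" "L' = v X'" "X' = X \<or> X' \<in> included ` set cs"
    "\<forall>c\<in>set cs. v (included c) \<le> L' \<and> (c \<in> T' \<or> is_leaf c \<or> lp_value t f g H n \<le> L')"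
proof -
  have "T \<subseteq> T' \<and> T' \<subseteq> T \<union> {c \<in> set cs. \<not> is_leaf c} \<and>
    L \<le> L' \<and> L' = v X' \<and> (X' = X \<or> X' \<in> included ` set cs) \<and>
    (\<forall>c\<in>set cs. v (included c) \<le> L' \<and> (c \<in> T' \<or> is_leaf c \<or> lp_value t f g H n \<le> L'))"
    using assms
  proof (induction cs arbitrary: T L X)
    case (Cons c cs)
    obtain T1 L1 X1 where visit: "bb_visit v t f g H n c (T, L, X) = (T1, L1, X1)"
      by (metis prod_cases3)
    then have first: "T \<subseteq> T1" "T1 \<subseteq> T \<union> {c' \<in> {c}. \<not> is_leaf c'}" "L \<le> L1" "L1 = v X1"
        "X1 = X \<or> X1 = included c" "v (included c) \<le> L1"
        "c \<in> T1 \<or> is_leaf c \<or> lp_value t f g H n \<le> L1"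
      using Cons.prems(2) by (auto simp: bb_visit_def Let_def split: if_splits)
    have "fold (bb_visit v t f g H n) cs (T1, L1, X1) = (T', L', X')"
      using Cons.prems(1) visit by simp
    from Cons.IH[OF this first(4)] first show ?case by (auto intro: order_trans)
  qed auto
  then show "T \<subseteq> T'" "T' \<subseteq> T \<union> {c \<in> set cs. \<not> is_leaf c}"
    "L \<le> L'" "L' = v X'" "X' = X \<or> X' \<in> included ` set cs"
    "\<forall>c\<in>set cs. v (included c) \<le> L' \<and> (c \<in> T' \<or> is_leaf c \<or> lp_value t f g H n \<le> L')"
    by blast+
qed

section \<open>The loop invariant\<close>

definition bb_invariant ::
    "nat \<Rightarrow> (nat set \<Rightarrow> real) \<Rightarrow> (nat \<Rightarrow> real) \<Rightarrow> real \<Rightarrow> bb_state \<Rightarrow> bool" where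
  "bb_invariant m v g H = (\<lambda>(T, L, X).
     finite T \<and> (\<forall>n\<in>T. is_node m g H n \<and> \<not> is_leaf n) \<and>
     feasible_portfolio m g H X \<and> L = v X \<and>
     (\<forall>Y. feasible_portfolio m g H Y \<longrightarrow> v Y \<le> L \<or> (\<exists>n\<in>T. compatible n Y)))"

text \<open>Every portfolio is compatible with the root, which is not a leaf because m is
  positive.\<close>

lemma bb_invariant_init:
  assumes "0 \<le> H" "0 < m" "v {} = 0"
  shows "bb_invariant m v g H (bb_init m)"
  using assms
  by (auto simp: bb_invariant_def bb_init_def is_node_def feasible_portfolio_def compatible_def)

text \<open>Only two events can uncover a portfolio: pruning a candidate and replacing
  \<open>n\<close> by its children. In both, \<open>bound\<close> shows that what is lost does not
  beat the new incumbent. Taking \<open>bound\<close> as a premise keeps probability out of the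
  analysis of the loop.\<close>

lemma bb_invariant_step:
  assumes "bb_step v t f g H s s'" "bb_invariant m v g H s"
    and g: "\<forall>j\<in>{1..m}. 0 \<le> g j"
    and bound: "\<And>n Y. is_node m g H n \<Longrightarrow> feasible_portfolio m g H Y \<Longrightarrow> compatible n Y \<Longrightarrow>
      v Y \<le> lp_value t f g H n"
  shows "bb_invariant m v g H s'"
  using assms(1)
proof cases
  case (1 n T cs L X T' L' X')
  have inv: "finite T" "\<forall>n\<in>T. is_node m g H n \<and> \<not> is_leaf n"
      "feasible_portfolio m g H X" "L = v X"
      "\<And>Y. feasible_portfolio m g H Y \<Longrightarrow> v Y \<le> L \<or> (\<exists>n\<in>T. compatible n Y)"
    using assms(2) by (auto simp: 1(1) bb_invariant_def)
  note fold = fold_bb_visit[OF 1(7) inv(4)]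
  have n: "is_node m g H n" "\<not> is_leaf n" using inv(2) 1(3) by auto
  have child: "is_node m g H c" if "c \<in> set cs" for c
    using children_are_nodes[OF 1(5) n(1) that] .
  have child_feasible: "feasible_portfolio m g H (included c)" if "c \<in> set cs" for c
    using child[OF that] is_node_subset(1)[OF child[OF that]]
    by (simp add: is_node_def feasible_portfolio_def)
  define T'' where "T'' = T' - {n''. L' > lp_value t f g H n''}"
  have T'_nodes: "is_node m g H n' \<and> \<not> is_leaf n'" if "n' \<in> T'" for n'
    using that fold(2) inv(2) child by blast
  \<comment> \<open>Pruning is harmless: a portfolio compatible with a pruned node is worth at most
    the bound of that node, which is below L'.\<close>
  have survivor: "v Y \<le> L' \<or> (\<exists>n\<in>T''. compatible n Y)"
    if "feasible_portfolio m g H Y" "n' \<in> T'" "compatible n' Y" for n' Y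
  proof (cases "n' \<in> T''")
    case False
    then have "lp_value t f g H n' < L'" using that(2) by (simp add: T''_def)
    moreover have "v Y \<le> lp_value t f g H n'" using T'_nodes that by (intro bound) blast+
    ultimately show ?thesis by linarith
  qed (use that(3) in blast)
  have "v Y \<le> L' \<or> (\<exists>n\<in>T''. compatible n Y)" if Y: "feasible_portfolio m g H Y" for Y
  proof -
    from inv(5)[OF Y] consider "v Y \<le> L" | n' where "n' \<in> T - {n}" "compatible n' Y"
      | "compatible n Y" by blast
    then show ?thesis
    proof cases
      case 1
      then show ?thesis using fold(3) by linarith
    next
      case 2
      then show ?thesis using survivor[OF Y] fold(1) by blast
    next
      case 3
      then obtain c where c: "c \<in> set cs" "compatible c Y"
        using compatible_child[OF \<open>children t f g H n (set cs)\<close> n g Y] by blast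
      consider "c \<in> T'" | "is_leaf c" | "lp_value t f g H n \<le> L'" using fold(6) c(1) by blast
      then show ?thesis
      proof cases
        case 1
        then show ?thesis using survivor[OF Y _ c(2)] by blast
      next
        case 2
        then have "Y = included c" using c(2) by (auto simp: compatible_def)
        then show ?thesis using fold(6) c(1) by blast
      next
        \<comment> \<open>The child was rejected by the bound of its parent \<open>n\<close>. As
          \<open>Y\<close> is compatible with \<open>n\<close> itself, that bound applies to
          \<open>Y\<close> directly, without comparing the bounds of parent and child.\<close>
        case le: 3
        have "v Y \<le> lp_value t f g H n" using n(1) Y 3 by (rule bound)
        then show ?thesis using le by linarith
      qed
    qed
  qed
  moreover have "finite T'" using fold(2) inv(1) finite_subset by fastforce
  moreover have "feasible_portfolio m g H X'" using fold(5) inv(3) child_feasible by blast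
  ultimately show ?thesis
    using T'_nodes fold(4) unfolding 1(2) T''_def bb_invariant_def by simp
qed

lemma bb_invariant_reachable:
  assumes "bb_reachable m v t f g H s" "0 \<le> H" "0 < m" "v {} = 0" "\<forall>j\<in>{1..m}. 0 \<le> g j"
    and "\<And>n Y. is_node m g H n \<Longrightarrow> feasible_portfolio m g H Y \<Longrightarrow> compatible n Y \<Longrightarrow>
      v Y \<le> lp_value t f g H n"
  shows "bb_invariant m v g H s"
  using assms(1)
proof (induction rule: rtranclp_induct)
  case base
  show ?case using assms(2-4) by (rule bb_invariant_init)
next
  case (step s s')
  show ?case using step.hyps(2) step.IH assms(5,6) by (rule bb_invariant_step)
qed

section \<open>Termination and correctness of the loop\<close>

definition bb_weight :: "bb_state \<Rightarrow> nat" where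
  "bb_weight = (\<lambda>(T, L, X). \<Sum>n\<in>T. 3 ^ card (undecided n))"

text \<open>A pass exchanges \<open>n\<close> for some of its children, whose total weight is
  smaller than that of \<open>n\<close>; pruning can only lower the weight further.\<close>

lemma bb_weight_decreases:
  assumes "bb_step v t f g H s s'" "bb_invariant m v g H s"
  shows "bb_weight s' < bb_weight s"
  using assms(1)
proof cases
  case (1 n T cs L X T' L' X')
  let ?w = "\<lambda>n. (3 :: nat) ^ card (undecided n)"
  have T: "finite T" "is_node m g H n" "L = v X"
    using assms(2) \<open>n \<in> T\<close> by (auto simp: 1(1) bb_invariant_def)
  have "T' - {n''. L' > lp_value t f g H n''} \<subseteq> (T - {n}) \<union> set cs"
    using fold_bb_visit(2)[OF 1(7) T(3)] by blast
  then have "bb_weight s' \<le> sum ?w ((T - {n}) \<union> set cs)"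
    using T(1) by (simp add: 1(2) bb_weight_def sum_mono2)
  \<comment> \<open>Subadditivity covers the possibility that a child is already a
    candidate.\<close>
  also have "\<dots> \<le> sum ?w (T - {n}) + sum ?w (set cs)"
    using T(1) by (simp add: sum_Un_nat)
  also have "\<dots> < sum ?w (T - {n}) + ?w n"
    using card_undecided_children[OF 1(5) is_node_subset(4)[OF T(2)]] by simp
  also have "\<dots> = bb_weight s"
    using sum.remove[OF T(1) \<open>n \<in> T\<close>, of ?w] by (simp add: 1(1) bb_weight_def)
  finally show ?thesis .
qed

lemma ex_bb_step:
  assumes "bb_invariant m v g H (T, L, X)" "T \<noteq> {}"
  shows "\<exists>s'. bb_step v t f g H (T, L, X) s'"
proof -
  let ?b = "lp_value t f g H"
  have T: "finite T" "\<forall>n\<in>T. is_node m g H n"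
    using assms(1) by (auto simp: bb_invariant_def)
  then have "Max (?b ` T) \<in> ?b ` T" using assms(2) by simp
  then obtain n where n: "n \<in> T" "?b n = Max (?b ` T)" by force
  have max: "\<forall>n'\<in>T. ?b n' \<le> ?b n" using T(1) n(2) by simp
  obtain K where "finite K" "children t f g H n K"
    using ex_children[OF is_node_subset(4)[OF bspec[OF T(2) n(1)]]] by blast
  then obtain cs where cs: "children t f g H n (set cs)" "distinct cs"
    using finite_distinct_list by blast
  obtain T' L' X' where "fold (bb_visit v t f g H n) cs (T - {n}, L, X) = (T', L', X')"
    by (metis prod_cases3)
  from bb_step.intros[OF n(1) max cs this] show ?thesis by blast
qed

text \<open>Stated for an arbitrary value function bounded by the linear programs. An infinite run
  would make \<open>bb_weight\<close> descend forever in the naturals; with no candidates left, the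
  invariant says that every feasible portfolio is worth at most the incumbent.\<close>

theorem bb_correct:
  assumes "0 \<le> H" "0 < m" "v {} = 0" "\<forall>j\<in>{1..m}. 0 \<le> g j"
    and "\<And>n Y. is_node m g H n \<Longrightarrow> feasible_portfolio m g H Y \<Longrightarrow> compatible n Y \<Longrightarrow>
      v Y \<le> lp_value t f g H n"
  shows "bb_terminates m v t f g H"
    and "bb_returns m v t f g H X L \<Longrightarrow> optimal_portfolio m v g H X"
proof -
  have inv: "bb_invariant m v g H s" if "bb_reachable m v t f g H s" for s
    using that assms by (rule bb_invariant_reachable)
  have False if \<sigma>: "\<sigma> 0 = bb_init m" "\<forall>i. bb_step v t f g H (\<sigma> i) (\<sigma> (Suc i))" for \<sigma>
  proof -
    have "bb_reachable m v t f g H (\<sigma> i)" for i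
      using \<sigma> by (induction i) (auto intro: rtranclp.rtrancl_into_rtrancl)
    then have "bb_weight (\<sigma> (Suc i)) < bb_weight (\<sigma> i)" for i
      using bb_weight_decreases inv \<sigma>(2) by blast
    moreover have "\<nexists>w :: nat \<Rightarrow> nat. \<forall>i. w (Suc i) < w i"
      using wf_less_than unfolding wf_iff_no_infinite_down_chain less_than_iff .
    ultimately show False by (auto dest: spec[of _ "\<lambda>i. bb_weight (\<sigma> i)"])
  qed
  moreover have "\<exists>s'. bb_step v t f g H (T, L, X) s'"
    if "bb_reachable m v t f g H (T, L, X)" "T \<noteq> {}" for T L X
    using inv[OF that(1)] that(2) by (rule ex_bb_step)
  ultimately show "bb_terminates m v t f g H" unfolding bb_terminates_def by blast
  show "optimal_portfolio m v g H X" if "bb_returns m v t f g H X L"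
    using inv[of "({}, L, X)"] that
    by (auto simp: bb_returns_def bb_invariant_def optimal_portfolio_def)
qed

theorem theorem7:
  fixes m :: nat and t f g :: "nat \<Rightarrow> real" and H :: real
    and M :: "'w measure" and Z :: "nat \<Rightarrow> 'w \<Rightarrow> bool"
  assumes "\<forall>j\<in>{1..m}. 0 < t j"
    and "\<forall>j\<in>{1..m}. 0 < f j \<and> f j \<le> 1"
    and "\<forall>j\<in>{1..m}. 0 < g j"
    and "0 < H"
    and "\<forall>j\<in>{1..m}. g j \<le> H"
    and "(\<Sum>j\<in>{1..m}. g j) > H"
    and "prob_space M"
    and "prob_space.indep_vars M (\<lambda>_. count_space UNIV) Z {1..m}"
    and "\<forall>j\<in>{1..m}. distr M (count_space UNIV) (Z j) = measure_pmf (bernoulli_pmf (f j))"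
  shows "bb_terminates m (portfolio_value M Z t) t f g H \<and>
    (\<forall>X L. bb_returns m (portfolio_value M Z t) t f g H X L \<longrightarrow>
       optimal_portfolio m (portfolio_value M Z t) g H X)"
proof -
  interpret admission_lottery M m f Z
    using assms(2,7-9)
    by (auto simp: admission_lottery_def admission_lottery_axioms_def less_imp_le)
  have "portfolio_value M Z t Y \<le> lp_value t f g H n"
    if "is_node m g H n" "feasible_portfolio m g H Y" "compatible n Y" for n Y
    using that assms(1) by (intro portfolio_value_le_lp_value) (auto simp: less_imp_le)
  \<comment> \<open>For m = 0 the total cost would be 0 and could not exceed the positive
    \<open>H\<close>.\<close>
  moreover have "0 < m" using assms(4,6) by (cases m) auto
  moreover have "portfolio_value M Z t {} = 0" by (simp add: portfolio_value_def)
  moreover have "\<forall>j\<in>{1..m}. 0 \<le> g j" using assms(3) by (simp add: less_imp_le)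
  ultimately show ?thesis
    using bb_correct[of H m "portfolio_value M Z t" g t f] assms(4) by auto
qed

end
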